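(* Let $n$ be a non-negative integer and let $\beta$ be a real number with $\beta\ge 2e^{n}$. If $p\in\mathcal{H}_1$ satisfies $$1+\beta\frac{zp'(z)}{p^{n+1}(z)}\prec\frac{2+z}{2-z},$$ then $p(z)\prec e^z$.
   Context: $\mathbb{D}=\{z\in\mathbb{C}:|z|<1\}$. $\mathcal{H}_1$ is the class of analytic functions on $\mathbb{D}$ of the form $p(z)=1+a_1z+a_2z^2+\cdots$. $p^{k}(z)$ means $(p(z))^{k}$. For functions $F,G$ analytic in $\mathbb{D}$, $F\prec G$ (F is subordinate to G) means there is an analytic $w:\mathbb{D}\to\mathbb{C}$ with $w(0)=0$, $|w(z)|<1$ and $F(z)=G(w(z))$ for all $z\in\mathbb{D}$; writing $F\prec G$ presupposes that $F$ and $G$ are analytic in $\mathbb{D}$. *)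

theory Defs
  imports "HOL-Complex_Analysis.Complex_Analysis"
begin

abbreviation unit_disc :: "complex set" where
  "unit_disc \<equiv> ball 0 1"

definition class_H1 :: "(complex \<Rightarrow> complex) set" where
  "class_H1 = {p. p analytic_on unit_disc \<and> p 0 = 1}"

text \<open>Analyticity of both functions on the disc is part of the relation. Values off the disc
  are irrelevant.\<close>

definition subordinate :: "(complex \<Rightarrow> complex) \<Rightarrow> (complex \<Rightarrow> complex) \<Rightarrow> bool"
  (infix "\<prec>\<prec>" 50) where
  "F \<prec>\<prec> G \<longleftrightarrow>
     F analytic_on unit_disc \<and> G analytic_on unit_disc \<and>
     (\<exists>w. w analytic_on unit_disc \<and> w 0 = 0 \<and>
          (\<forall>z\<in>unit_disc. norm (w z) < 1 \<and> F z = G (w z)))"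

end

(* By the Schwarz lemma the hypothesis reads p' = g p^(n+1), where g is analytic on the disc and
   |g| <= 2 / beta <= exp (- n). Being a solution of the linear equation p' = (g p^n) p, the
   function p is exp q with q' = g p^n and q 0 = 0. Then exp (- n q) has derivative - n g, so it
   lies within n exp (- n) |z| of 1. Since 1 - n exp (- n) >= exp (- n), taking logarithms gives
   |n q| < n. For n = 0 the bound |q| < 1 follows directly from |q'| <= 1. *)

theory Submission
  imports Defs
begin

text \<open>Termwise comparison of power series: the \<open>n\<close>-th terms of the two expansions
  have the same modulus. The terms at index 0 are divisions by zero and hence vanish on both
  sides.\<close>

lemma norm_Ln_one_plus_le:
  assumes "norm z < 1"
  shows "norm (Ln (1 + z)) \<le> - ln (1 - norm z)"
proof (rule norm_sums_le)
  show "(\<lambda>n. - ((-z)^n) / of_nat n) sums Ln (1 + z)"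
    using assms by (rule Ln_series')
  show "(\<lambda>n. norm z ^ n / real n) sums (- ln (1 - norm z))"
    using sums_minus[OF ln_series'[of "- norm z"]] assms by simp
qed (simp add: norm_divide norm_power)

text \<open>While \<open>exp (q x)\<close> avoids the branch cut,
  \<open>Ln (exp (q x)) - q x\<close> has derivative 0. It is thus constant on the connected set,
  and its value at \<open>a\<close> is 0. No bound on \<open>Im (q x)\<close> has to be known
  beforehand.\<close>

lemma Ln_exp_eq_on_connected:
  assumes S: "open S" "connected S" and q: "q holomorphic_on S"
    and a: "a \<in> S" "q a = 0" and z: "z \<in> S"
    and slit: "\<And>x. x \<in> S \<Longrightarrow> exp (q x) \<notin> \<real>\<^sub>\<le>\<^sub>0"
  shows "Ln (exp (q z)) = q z"
proof -
  let ?d = "\<lambda>x. Ln (exp (q x)) - q x"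
  have deriv: "DERIV ?d x :> 0" if "x \<in> S" for x
    using that slit holomorphic_derivI[OF q S(1)]
    by (auto intro!: derivative_eq_intros)
  then have "continuous_on S ?d"
    by (intro continuous_at_imp_continuous_on) (auto intro: DERIV_isCont)
  then obtain c where "\<And>x. x \<in> S \<Longrightarrow> ?d x = c"
    using DERIV_zero_connected_constant[of S "{}" ?d] S deriv by auto
  then have "?d z = ?d a"
    using a(1) z by metis
  then show ?thesis
    using a by simp
qed

text \<open>Integrating factor: if \<open>q\<close> is the primitive of \<open>h\<close> that
  vanishes at \<open>a\<close>, then \<open>p * exp (- q)\<close> has derivative 0 and equals 1 at
  \<open>a\<close>. In particular \<open>p\<close> has no zeros on \<open>S\<close>.\<close>

lemma linear_ode_solution_exp:
  fixes p h :: "complex \<Rightarrow> complex"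
  assumes S: "open S" "convex S" "a \<in> S" and h: "h holomorphic_on S"
    and p: "\<And>z. z \<in> S \<Longrightarrow> (p has_field_derivative h z * p z) (at z)" and "p a = 1"
  obtains q where "q a = 0" "\<And>z. z \<in> S \<Longrightarrow> (q has_field_derivative h z) (at z)"
    "\<And>z. z \<in> S \<Longrightarrow> p z = exp (q z)"
proof -
  obtain f where f: "\<And>z. z \<in> S \<Longrightarrow> (f has_field_derivative h z) (at z within S)"
    using holomorphic_convex_primitive'[OF S(2,1) h] by blast
  define q where "q = (\<lambda>z. f z - f a)"
  have q: "(q has_field_derivative h z) (at z)" if "z \<in> S" for z
  proof -
    have "(f has_field_derivative h z) (at z)"
      using f[OF that] unfolding at_within_open[OF that S(1)] .
    from DERIV_diff[OF this DERIV_const[of "f a"]] show ?thesis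
      unfolding q_def by (simp only: diff_0_right)
  qed
  have "((\<lambda>x. p x * exp (- q x)) has_field_derivative 0) (at z within S)" if "z \<in> S" for z
  proof (rule has_field_derivative_at_within)
    have "((\<lambda>x. exp (- q x)) has_field_derivative exp (- q z) * - h z) (at z)"
      by (intro DERIV_fun_exp DERIV_minus q that)
    from DERIV_mult[OF p[OF that] this]
    show "((\<lambda>x. p x * exp (- q x)) has_field_derivative 0) (at z)"
      by (simp add: algebra_simps)
  qed
  then obtain c where c: "\<And>z. z \<in> S \<Longrightarrow> p z * exp (- q z) = c"
    using has_field_derivative_zero_constant[OF S(2), of "\<lambda>x. p x * exp (- q x)"] by blast
  have "p z * exp (- q z) = 1" if "z \<in> S" for z
    using c[OF that] c[OF S(3)] \<open>p a = 1\<close> by (simp add: q_def)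
  then have "p z = exp (q z)" if "z \<in> S" for z
    using that by (simp add: exp_minus field_simps)
  then show ?thesis
    using q by (intro that[of q]) (auto simp: q_def)
qed

text \<open>Away from 0 the bound is the Schwarz lemma divided by \<open>norm z\<close>; at 0 the
  factor equals \<open>deriv w 0\<close>, which the derivative part of the same lemma
  bounds.\<close>

lemma Schwarz_factor:
  assumes w: "w holomorphic_on ball 0 1" "w 0 = 0" "\<And>z. norm z < 1 \<Longrightarrow> norm (w z) < 1"
  obtains \<phi> where "\<phi> holomorphic_on ball 0 1" "\<And>z. norm z < 1 \<Longrightarrow> w z = z * \<phi> z"
    "\<And>z. norm z < 1 \<Longrightarrow> norm (\<phi> z) \<le> 1"
proof -
  obtain \<phi> where \<phi>: "\<phi> holomorphic_on ball 0 1" "\<And>z. norm z < 1 \<Longrightarrow> w z = z * \<phi> z" "deriv w 0 = \<phi> 0"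
    using Schwarz3[OF w(1,2)] by blast
  have "norm (\<phi> z) \<le> 1" if "norm z < 1" for z
  proof (cases "z = 0")
    case True
    then show ?thesis
      using Schwarz_Lemma(2)[OF w, of 0] \<phi>(3) by simp
  next
    case False
    then show ?thesis
      using Schwarz_Lemma(1)[OF w that] \<phi>(2)[OF that] by (simp add: norm_mult)
  qed
  with \<phi> show ?thesis
    using that by blast
qed

text \<open>This is what makes \<open>q\<close> a subordinating function for \<open>exp q\<close>.
  The equation is of Bernoulli type, and passing to \<open>exp (- n q)\<close> removes the
  nonlinearity.\<close>

lemma exp_dominated_by_unit_ball:
  fixes q g :: "complex \<Rightarrow> complex" and n :: nat
  assumes q0: "q 0 = 0"
    and q: "\<And>z. norm z < 1 \<Longrightarrow> (q has_field_derivative g z * exp (q z) ^ n) (at z)"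
    and g: "\<And>z. norm z < 1 \<Longrightarrow> norm (g z) \<le> exp (- real n)"
    and z: "norm z < 1"
  shows "norm (q z) < 1"
proof (cases "n = 0")
  case True
  have "norm (q z - q 0) \<le> 1 * norm (z - 0)"
    by (rule field_differentiable_bound[of "ball 0 1" q g])
      (use True q g z in \<open>auto intro: has_field_derivative_at_within\<close>)
  then show ?thesis
    using q0 z by simp
next
  case False
  let ?Q = "\<lambda>x. - of_nat n * q x"
  have lip: "norm (exp (?Q x) - 1) \<le> real n * exp (- real n) * norm x" if "norm x < 1" for x
  proof -
    \<comment> \<open>This cancels the factor \<open>exp (q y) ^ n\<close> of the derivative of
      \<open>q\<close>, leaving only \<open>- n * g y\<close>.\<close>
    have "exp (?Q y) * exp (q y) ^ n = 1" for y
      by (simp add: exp_of_nat_mult[symmetric] exp_add[symmetric])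
    then have "((\<lambda>x. exp (?Q x)) has_field_derivative - of_nat n * g y) (at y)" if "norm y < 1" for y
      using that by (auto intro!: derivative_eq_intros q)
    moreover have "norm (- of_nat n * g y) \<le> real n * exp (- real n)" if "norm y < 1" for y
      using g[OF that] by (simp add: norm_mult mult_left_mono)
    ultimately have "norm (exp (?Q x) - exp (?Q 0)) \<le> real n * exp (- real n) * norm (x - 0)"
      using that
      by (intro field_differentiable_bound[of "ball 0 1" _ "\<lambda>y. - of_nat n * g y"])
        (auto intro: has_field_derivative_at_within)
    then show ?thesis
      using q0 by simp
  qed
  \<comment> \<open>The inequality 1 + n \<le> e^n, scaled by e^(-n), is what makes the final
    logarithm at most n.\<close>
  have "(1 + real n) * exp (- real n) \<le> exp (real n) * exp (- real n)"
    by (intro mult_right_mono exp_ge_add_one_self) auto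
  then have gap: "exp (- real n) \<le> 1 - real n * exp (- real n)"
    by (simp add: exp_minus algebra_simps)
  have less: "norm (exp (?Q x) - 1) < real n * exp (- real n)" if "norm x < 1" for x
  proof -
    have "real n * exp (- real n) * norm x < real n * exp (- real n) * 1"
      using that False by (intro mult_strict_left_mono) auto
    then show ?thesis
      using lip[OF that] by linarith
  qed
  then have lt1: "norm (exp (?Q x) - 1) < 1" if "norm x < 1" for x
    using less[OF that] gap exp_gt_zero[of "- real n"] by linarith
  have "q holomorphic_on ball 0 1"
    unfolding holomorphic_on_open[OF open_ball] by (intro ballI exI, rule q) simp
  then have "?Q holomorphic_on ball 0 1"
    by (intro holomorphic_intros)
  \<comment> \<open>The open disc of radius 1 about 1 lies in the right half-plane, away from the
    branch cut.\<close>
  moreover have "exp (?Q x) \<notin> \<real>\<^sub>\<le>\<^sub>0" if "norm x < 1" for x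
  proof
    assume "exp (?Q x) \<in> \<real>\<^sub>\<le>\<^sub>0"
    then have "Re (exp (?Q x) - 1) \<le> - 1"
      by (simp add: complex_nonpos_Reals_iff del: Re_exp)
    then show False
      using abs_Re_le_cmod[of "exp (?Q x) - 1"] lt1[OF that] by linarith
  qed
  ultimately have "Ln (exp (?Q z)) = ?Q z"
    using z q0 by (intro Ln_exp_eq_on_connected[of "ball 0 1" _ 0]) auto
  then have "norm (?Q z) \<le> - ln (1 - norm (exp (?Q z) - 1))"
    using norm_Ln_one_plus_le[OF lt1[OF z]] by simp
  also have "\<dots> < real n"
  proof -
    have "exp (- real n) < 1 - norm (exp (?Q z) - 1)"
      using less[OF z] gap by linarith
    then have "ln (exp (- real n)) < ln (1 - norm (exp (?Q z) - 1))"
      by (subst ln_less_cancel_iff) (use lt1[OF z] in auto)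
    then show ?thesis
      by simp
  qed
  finally show ?thesis
    using False by (simp add: norm_mult)
qed

theorem theorem3p3:
  fixes n :: nat and \<beta> :: real and p :: "complex \<Rightarrow> complex"
  assumes "\<beta> \<ge> 2 * exp (real n)"
    and "p \<in> class_H1"
    and "(\<lambda>z. 1 + of_real \<beta> * (z * deriv p z / p z ^ (n + 1))) \<prec>\<prec> (\<lambda>z. (2 + z) / (2 - z))"
  shows "p \<prec>\<prec> exp"
proof -
  have \<beta>: "\<beta> > 0"
    using assms(1) exp_gt_zero[of "real n"] by linarith
  have p: "p holomorphic_on ball 0 1" "p 0 = 1"
    using assms(2) by (auto simp: class_H1_def analytic_on_open)
  obtain w where w: "w holomorphic_on ball 0 1" "w 0 = 0" "\<And>z. norm z < 1 \<Longrightarrow> norm (w z) < 1"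
    and eq: "\<And>z. norm z < 1 \<Longrightarrow>
      1 + of_real \<beta> * (z * deriv p z / p z ^ (n + 1)) = (2 + w z) / (2 - w z)"
    using assms(3) unfolding subordinate_def by (auto simp: analytic_on_open)
  obtain \<phi> where \<phi>: "\<phi> holomorphic_on ball 0 1" "\<And>z. norm z < 1 \<Longrightarrow> w z = z * \<phi> z"
    "\<And>z. norm z < 1 \<Longrightarrow> norm (\<phi> z) \<le> 1"
    using Schwarz_factor[OF w] by blast
  have far: "norm (2 - w z) \<ge> 1" if "norm z < 1" for z
    using norm_triangle_ineq2[of 2 "w z"] w(3)[OF that] by simp
  then have nz: "2 - w z \<noteq> 0" if "norm z < 1" for z
    using that by fastforce
  \<comment> \<open>Since (2 + w)/(2 - w) - 1 = 2w/(2 - w) and w = z \<phi>, dividing by \<beta> z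
    turns the hypothesis into p'/p^(n+1) = g.\<close>
  define g where "g = (\<lambda>z. 2 * \<phi> z / (of_real \<beta> * (2 - w z)))"
  have holg: "g holomorphic_on ball 0 1"
    unfolding g_def using \<beta> nz by (intro holomorphic_intros w \<phi>) auto
  have g: "norm (g z) \<le> exp (- real n)" if "norm z < 1" for z
  proof -
    have "norm (g z) = 2 * norm (\<phi> z) / (\<beta> * norm (2 - w z))"
      using \<beta> by (simp add: g_def norm_mult norm_divide)
    also have "\<dots> \<le> 2 * 1 / (\<beta> * 1)"
      using \<phi>(3)[OF that] far[OF that] \<beta> by (intro frac_le mult_left_mono) auto
    \<comment> \<open>The lower bound on \<beta> enters here: it is exactly what brings 2/\<beta>
      down to e^(-n).\<close>
    also have "\<dots> \<le> 2 * 1 / (2 * exp (real n))"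
      using assms(1) \<beta> by (intro divide_left_mono) auto
    finally show ?thesis
      by (simp add: exp_minus inverse_eq_divide)
  qed
  text \<open>Where \<open>p\<close> vanishes the hypothesis divides by zero and says nothing about \<open>deriv p\<close>.
    The differential equation is therefore read off near \<open>0\<close> and continued analytically.\<close>
  define D where "D = (\<lambda>z. deriv p z - g z * p z ^ (n + 1))"
  have D0: "D z = 0" if z: "norm z < 1" "z \<noteq> 0" "p z \<noteq> 0" for z
  proof -
    have "of_real \<beta> * (z * deriv p z / p z ^ (n + 1)) = (2 + w z) / (2 - w z) - 1"
      using eq[OF z(1)] by (simp add: algebra_simps)
    also have "\<dots> = of_real \<beta> * (z * g z)"
      using nz[OF z(1)] \<beta> \<phi>(2)[OF z(1)] by (simp add: g_def divide_simps)
    finally have "of_real \<beta> * z * (deriv p z / p z ^ (n + 1)) = of_real \<beta> * z * g z"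
      by (simp only: times_divide_eq_right mult.assoc)
    then have "deriv p z / p z ^ (n + 1) = g z"
      using \<beta> z(2) by (subst (asm) mult_left_cancel) auto
    then show ?thesis
      using z(3) by (simp add: D_def divide_simps)
  qed
  have ode: "deriv p z = g z * p z ^ n * p z" if z: "norm z < 1" for z
  proof -
    have "isCont p 0"
      using p(1) by (intro holomorphic_on_imp_differentiable_at[THEN field_differentiable_imp_continuous_at]) auto
    then obtain e where e: "e > 0" "\<And>x. norm x < e \<Longrightarrow> p x \<noteq> 0"
      using continuous_at_avoid[of 0 p 0] p(2) by (auto simp: dist_norm)
    let ?r = "min e 1"
    \<comment> \<open>The centre must be left out because \<open>D0\<close> divides by
      \<open>z\<close>, but 0 stays a limit point of the punctured ball, as the identity theorem
      requires.\<close>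
    have "0 islimpt ball (0::complex) ?r"
      using e(1) by (simp add: islimpt_ball)
    then have "0 islimpt (ball (0::complex) ?r - {0})"
      by (simp add: islimpt_punctured[symmetric])
    moreover have "D holomorphic_on ball 0 1"
      unfolding D_def by (intro holomorphic_intros p holg) auto
    moreover have "D x = 0" if "x \<in> ball 0 ?r - {0}" for x
      using that e(2)[of x] by (intro D0) auto
    ultimately have "D z = 0"
      using z by (intro analytic_continuation[of D "ball 0 1" "ball 0 ?r - {0}" 0 z])
        (simp_all only: open_ball connected_ball, auto)
    then show ?thesis
      by (simp add: D_def)
  qed
  have "(p has_field_derivative g z * p z ^ n * p z) (at z)" if "z \<in> ball 0 1" for z
    using holomorphic_derivI[OF p(1) _ that] ode that by simp
  moreover have "(\<lambda>z. g z * p z ^ n) holomorphic_on ball 0 1"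
    by (intro holomorphic_intros p holg)
  ultimately obtain q where q: "q 0 = 0"
    "\<And>z. z \<in> ball 0 1 \<Longrightarrow> (q has_field_derivative g z * p z ^ n) (at z)"
    "\<And>z. z \<in> ball 0 1 \<Longrightarrow> p z = exp (q z)"
    using linear_ode_solution_exp[of "ball 0 1" 0 "\<lambda>z. g z * p z ^ n" p] p(2) by auto
  have "q holomorphic_on ball 0 1"
    unfolding holomorphic_on_open[OF open_ball] using q(2) by blast
  moreover have "norm (q z) < 1" if "norm z < 1" for z
    using q(1) _ g that
  proof (rule exp_dominated_by_unit_ball)
    show "(q has_field_derivative g x * exp (q x) ^ n) (at x)" if "norm x < 1" for x
      using q(2)[of x] q(3)[of x] that by simp
  qed
  \<comment> \<open>The function \<open>q\<close> itself is the witness for the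
    subordination.\<close>
  ultimately show ?thesis
    unfolding subordinate_def analytic_on_open[OF open_ball]
    using p(1) q(1,3) by (auto intro: holomorphic_on_exp)
qed

end
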